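(* Let $n$ be a positive integer coprime to $3$. Then the Alexander polynomial of the torus knot $T(n,3)$ is the algebraic sum of Alexander polynomials of torus knots $T(k,2)$ given by $$\Delta_{n,3}(t)=\sum_{j=0}^{d_1}\Delta_{2n-1-6j,\,2}(t)-\sum_{i=0}^{d_2}\Delta_{2n-5-6i,\,2}(t),$$ where $d_1=\left[\frac{2n-1}{6}\right]$ and $d_2=\left[\frac{2n-5}{6}\right]$.
   Context: For coprime positive integers $n,l$, $\Delta_{n,l}(t)$ denotes the Alexander polynomial of the torus knot $T(n,l)$, normalized by the skein relation $\Delta_{+}(t)=(t^{1/2}-t^{-1/2})\Delta_{O}(t)+\Delta_{-}(t)$ together with $\Delta_{\rm unknot}=1$. It is the Laurent polynomial in $t$ given by the known formula $$\Delta_{n,l}(t)=\frac{(t^{nl/2}-t^{-nl/2})(t^{1/2}-t^{-1/2})}{(t^{n/2}-t^{-n/2})(t^{l/2}-t^{-l/2})}.$$ In particular, for odd $k\ge 1$, $\Delta_{k,2}(t)=\dfrac{t^{k/2}+t^{-k/2}}{t^{1/2}+t^{-1/2}}$ (so $\Delta_{1,2}=1$, $\Delta_{3,2}=t-1+t^{-1}$), and for $n$ coprime to $3$, $\Delta_{n,3}(t)=\dfrac{t^{n}+1+t^{-n}}{t+1+t^{-1}}$. Here $[y]$ denotes the integer part (floor) of $y$, and a sum $\sum_{i=0}^{d}$ with $d=-1$ is empty, hence $0$. *)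

theory Defs
  imports Complex_Main "HOL-Computational_Algebra.Formal_Laurent_Series"
begin

text \<open>
  Alexander polynomials of torus knots involve half-integral powers of \<open>t\<close>, so we compute in the
  field \<open>rat fls\<close> of formal Laurent series in the square root of \<open>t\<close>. It contains the Laurent
  polynomials in \<open>t\<close> with integer coefficients, and the quotient below is a quotient in a field.
\<close>

definition t_half_pow :: "int \<Rightarrow> rat fls"
  where "t_half_pow m = fls_X powi m"  \<comment> \<open>\<open>fls_X\<close> is the square root of \<open>t\<close>\<close>

text \<open>
  The closed formula for the Alexander polynomial of the torus knot \<open>T(n,l)\<close>, in the normalization
  fixed by the skein relation with coefficient \<open>t_half_pow 1 - t_half_pow (- 1)\<close> and value 1 on the unknot.
  Meaningful for coprime \<open>n, l > 0\<close> only: if \<open>n = 0\<close> or \<open>l = 0\<close> the denominator vanishes.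
\<close>

definition torus_alexander :: "int \<Rightarrow> int \<Rightarrow> rat fls"
  where "torus_alexander n l =
    ((t_half_pow (n * l) - t_half_pow (- (n * l))) * (t_half_pow 1 - t_half_pow (- 1))) /
    ((t_half_pow n - t_half_pow (- n)) * (t_half_pow l - t_half_pow (- l)))"

lemma t_half_pow_add: "t_half_pow (a + b) = t_half_pow a * t_half_pow b"
  by (simp add: t_half_pow_def power_int_add del: fls_X_power_int)

lemma t_half_pow_diff_neq_0:
  assumes "m \<noteq> 0"
  shows "t_half_pow m - t_half_pow (- m) \<noteq> 0"
proof
  assume "t_half_pow m - t_half_pow (- m) = 0"
  then have "fls_subdegree (t_half_pow m) = fls_subdegree (t_half_pow (- m))"
    by simp
  then show False
    using assms by (simp add: t_half_pow_def)
qed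

lemma torus_alexander_1_left:
  assumes "l \<noteq> 0"
  shows "torus_alexander 1 l = 1"
  using t_half_pow_diff_neq_0[OF assms] t_half_pow_diff_neq_0[of 1]
  by (simp add: torus_alexander_def)

lemma torus_alexander_3_2: "torus_alexander 3 2 = t_half_pow 2 - 1 + t_half_pow (- 2)"
proof -
  have e: "t_half_pow 6 - t_half_pow (- 6) =
      (t_half_pow 3 - t_half_pow (- 3)) * (t_half_pow 3 + t_half_pow (- 3))"
    and f: "t_half_pow 2 - t_half_pow (- 2) =
      (t_half_pow 1 - t_half_pow (- 1)) * (t_half_pow 1 + t_half_pow (- 1))"
    and g: "t_half_pow 3 + t_half_pow (- 3) =
      (t_half_pow 1 + t_half_pow (- 1)) * (t_half_pow 2 - 1 + t_half_pow (- 2))"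
    by (simp_all add: algebra_simps flip: t_half_pow_add)
  have "t_half_pow 2 - t_half_pow (- 2) \<noteq> 0" "t_half_pow 3 - t_half_pow (- 3) \<noteq> 0"
    using t_half_pow_diff_neq_0[of 2] t_half_pow_diff_neq_0[of 3] by simp_all
  then show ?thesis
    by (simp add: torus_alexander_def e f g)
qed

end

theory Submission
  imports Defs
begin

text \<open>
  Write \<open>q\<close> for the square root of \<open>t\<close> and \<open>D\<^sub>l(k)\<close> for the polynomial of \<open>T(k,l)\<close>. The closed
  formula says \<open>D\<^sub>3(n) (q\<^sup>2 + 1 + q\<^sup>-\<^sup>2) = q\<^sup>2\<^sup>n + 1 + q\<^sup>-\<^sup>2\<^sup>n\<close> and \<open>D\<^sub>2(k) (q + q\<^sup>-\<^sup>1) = q\<^sup>k + q\<^sup>-\<^sup>k\<close>.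
  Although the denominators differ, the increments \<open>D\<^sub>3(n + 3) - D\<^sub>3(n)\<close> and
  \<open>D\<^sub>2(2n + 5) - D\<^sub>2(2n + 1)\<close> agree: in each the denominator cancels and leaves
  \<open>(q\<^sup>2\<^sup>n\<^sup>+\<^sup>3 - q\<^sup>-\<^sup>2\<^sup>n\<^sup>-\<^sup>3) (q - q\<^sup>-\<^sup>1)\<close> (lemma \<open>torus_alexander_increment\<close>).

  Replacing \<open>n\<close> by \<open>n + 3\<close> on the right-hand side of the theorem shifts both summation indices by
  one, so it creates exactly one new term in each sum, and these are the two terms above. Hence
  both sides have the same increment from \<open>n\<close> to \<open>n + 3\<close>, and it suffices to compare them
  at \<open>n = 1\<close>, where both are 1, and at \<open>n = 2\<close>, where both are the trefoil polynomial. For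
  \<open>n = r + 3 m\<close> with \<open>r\<close> equal to 1 or 2, the summation bounds are \<open>m\<close> and \<open>m - 1\<close>.
\<close>

lemma torus_alexander_commute: "torus_alexander n l = torus_alexander l n"
  by (simp add: torus_alexander_def mult.commute)

lemma t_half_pow_diff_2:
  "t_half_pow 2 - t_half_pow (- 2) =
    (t_half_pow 1 - t_half_pow (- 1)) * (t_half_pow 1 + t_half_pow (- 1))"
  by (simp add: algebra_simps flip: t_half_pow_add)

lemma t_half_pow_diff_3:
  "t_half_pow 3 - t_half_pow (- 3) =
    (t_half_pow 1 - t_half_pow (- 1)) * (t_half_pow 2 + 1 + t_half_pow (- 2))"
  by (simp add: algebra_simps flip: t_half_pow_add)

lemma t_half_pow_denominators_neq_0:
  "t_half_pow 1 + t_half_pow (- 1) \<noteq> 0" "t_half_pow 2 + 1 + t_half_pow (- 2) \<noteq> 0"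
  using t_half_pow_diff_neq_0[of 2] t_half_pow_diff_neq_0[of 3] t_half_pow_diff_2 t_half_pow_diff_3
  by auto

lemma torus_alexander_2_mult:
  assumes "n \<noteq> 0"
  shows "torus_alexander n 2 * (t_half_pow 1 + t_half_pow (- 1)) = t_half_pow n + t_half_pow (- n)"
proof -
  have num: "t_half_pow (n * 2) - t_half_pow (- (n * 2)) =
      (t_half_pow n - t_half_pow (- n)) * (t_half_pow n + t_half_pow (- n))"
    by (simp add: algebra_simps flip: t_half_pow_add)
  show ?thesis
    using t_half_pow_diff_neq_0[OF assms] t_half_pow_diff_neq_0[of 1] t_half_pow_denominators_neq_0
    unfolding torus_alexander_def num t_half_pow_diff_2 by simp
qed

lemma torus_alexander_3_mult:
  assumes "n \<noteq> 0"
  shows "torus_alexander n 3 * (t_half_pow 2 + 1 + t_half_pow (- 2)) =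
    t_half_pow (2 * n) + 1 + t_half_pow (- (2 * n))"
proof -
  have num: "t_half_pow (n * 3) - t_half_pow (- (n * 3)) =
      (t_half_pow n - t_half_pow (- n)) * (t_half_pow (2 * n) + 1 + t_half_pow (- (2 * n)))"
    by (simp add: algebra_simps flip: t_half_pow_add)
  show ?thesis
    using t_half_pow_diff_neq_0[OF assms] t_half_pow_diff_neq_0[of 1] t_half_pow_denominators_neq_0
    unfolding torus_alexander_def num t_half_pow_diff_3 by simp
qed

text \<open>
  The factorization \<open>q\<^sup>a\<^sup>+\<^sup>b + q\<^sup>-\<^sup>a\<^sup>-\<^sup>b - q\<^sup>a\<^sup>-\<^sup>b - q\<^sup>b\<^sup>-\<^sup>a = (q\<^sup>a - q\<^sup>-\<^sup>a) (q\<^sup>b - q\<^sup>-\<^sup>b)\<close> at \<open>a = 2n + 3\<close> gives both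
  increments: \<open>b = 3\<close> for the left-hand side and \<open>b = 2\<close> for the right-hand side. In each case
  the denominator times \<open>q - q\<^sup>-\<^sup>1\<close> is \<open>q\<^sup>b - q\<^sup>-\<^sup>b\<close>.
\<close>

lemma torus_alexander_increment:
  assumes "n \<noteq> 0" "n + 3 \<noteq> 0"
  shows "torus_alexander (n + 3) 3 - torus_alexander n 3 =
    torus_alexander (2 * n + 5) 2 - torus_alexander (2 * n + 1) 2"
proof -
  let ?P = "(t_half_pow (2 * n + 3) - t_half_pow (- (2 * n + 3))) * (t_half_pow 1 - t_half_pow (- 1))"
  let ?d2 = "t_half_pow 1 + t_half_pow (- 1)" and ?d3 = "t_half_pow 2 + 1 + t_half_pow (- 2)"
  have "(torus_alexander (n + 3) 3 - torus_alexander n 3) * ?d3 = ?P * ?d3"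
    unfolding left_diff_distrib[of "torus_alexander _ _"] torus_alexander_3_mult[OF assms(1)]
      torus_alexander_3_mult[OF assms(2)]
    by (simp add: algebra_simps flip: t_half_pow_add)
  then have lhs: "torus_alexander (n + 3) 3 - torus_alexander n 3 = ?P"
    using t_half_pow_denominators_neq_0(2) by simp
  have odd: "2 * n + 5 \<noteq> 0" "2 * n + 1 \<noteq> 0"
    by presburger+
  have "(torus_alexander (2 * n + 5) 2 - torus_alexander (2 * n + 1) 2) * ?d2 = ?P * ?d2"
    unfolding left_diff_distrib[of "torus_alexander _ _"] torus_alexander_2_mult[OF odd(1)]
      torus_alexander_2_mult[OF odd(2)]
    by (simp add: algebra_simps flip: t_half_pow_add)
  then show ?thesis
    using lhs t_half_pow_denominators_neq_0(1) by simp
qed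

lemma sum_int_atLeast0_shift:
  fixes f :: "int \<Rightarrow> 'a::comm_monoid_add"
  assumes "d \<ge> - 1"
  shows "(\<Sum>j = 0..d + 1. f j) = f 0 + (\<Sum>j = 0..d. f (j + 1))"
proof -
  have "{0..d + 1} = insert 0 {1..d + 1}"
    using assms by auto
  moreover have "sum f {1..d + 1} = (\<Sum>j = 0..d. f (j + 1))"
    by (rule sum.reindex_bij_witness[of _ "\<lambda>j. j + 1" "\<lambda>j. j - 1"]) auto
  ultimately show ?thesis
    by simp
qed

text \<open>
  Induction along a residue class modulo 3. The sums for \<open>m\<close> reappear in those for \<open>m + 1\<close> with
  indices shifted up by one; the new terms sit at index 0.
\<close>

lemma torus_alexander_3_sum:
  fixes m :: nat and r :: int
  assumes "r \<in> {1, 2}"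
  shows "torus_alexander (r + 3 * int m) 3 =
    (\<Sum>j = 0..int m. torus_alexander (2 * (r + 3 * int m) - 1 - 6 * j) 2) -
    (\<Sum>i = 0..int m - 1. torus_alexander (2 * (r + 3 * int m) - 5 - 6 * i) 2)"
proof (induction m)
  case 0
  then show ?case
    using assms torus_alexander_commute[of 2 3] by (auto simp: torus_alexander_1_left)
next
  case (Suc m)
  let ?n = "r + 3 * int m" and ?n' = "r + 3 * int (Suc m)"
  have first: "(\<Sum>j = 0..int (Suc m). torus_alexander (2 * ?n' - 1 - 6 * j) 2) =
      torus_alexander (2 * ?n + 5) 2 + (\<Sum>j = 0..int m. torus_alexander (2 * ?n - 1 - 6 * j) 2)"
    using sum_int_atLeast0_shift[of "int m" "\<lambda>j. torus_alexander (2 * ?n' - 1 - 6 * j) 2"]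
    by (simp add: algebra_simps)
  have second: "(\<Sum>i = 0..int (Suc m) - 1. torus_alexander (2 * ?n' - 5 - 6 * i) 2) =
      torus_alexander (2 * ?n + 1) 2 + (\<Sum>i = 0..int m - 1. torus_alexander (2 * ?n - 5 - 6 * i) 2)"
    using sum_int_atLeast0_shift[of "int m - 1" "\<lambda>i. torus_alexander (2 * ?n' - 5 - 6 * i) 2"]
    by (simp add: algebra_simps)
  have left: "torus_alexander ?n' 3 =
      torus_alexander ?n 3 + (torus_alexander (2 * ?n + 5) 2 - torus_alexander (2 * ?n + 1) 2)"
    using assms torus_alexander_increment[of ?n] by (auto simp: algebra_simps)
  show ?case
    unfolding first second left Suc.IH by simp
qed

theorem proposition1:
  fixes n d1 d2 :: int
  assumes "n > 0" and "coprime n 3"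
    and "d1 = \<lfloor>(2 * real_of_int n - 1) / 6\<rfloor>"
    and "d2 = \<lfloor>(2 * real_of_int n - 5) / 6\<rfloor>"
  shows "torus_alexander n 3 =
    (\<Sum>j = 0..d1. torus_alexander (2 * n - 1 - 6 * j) 2) -
    (\<Sum>i = 0..d2. torus_alexander (2 * n - 5 - 6 * i) 2)"
proof -
  have "\<not> 3 dvd n"
    using assms(2) coprime_common_divisor[of n 3 3] by auto
  then have r: "n mod 3 \<in> {1, 2}"
    by auto presburger
  define m where "m = nat (n div 3)"
  have n: "n = n mod 3 + 3 * int m"
    using assms(1) by (simp add: m_def)
  have "real_of_int n = real_of_int (n mod 3) + 3 * real m"
    by (subst n) simp
  then have "d1 = int m" "d2 = int m - 1"
    using r unfolding assms(3,4) by (auto simp: floor_eq_iff)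
  then show ?thesis
    using torus_alexander_3_sum[OF r, of m] n by simp
qed

end
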